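(* Let $\delta\ge 1$, $a>0$ and $\beta>0$ be real numbers, and let $P^{(\delta)}$ be the transition operator on $(0,\infty)$ with transition density (for $x>0$) $$p^{(\delta)}(x,x')=1_{(x'>0)}\frac{2}{\beta\sqrt{2\pi}}\exp\Big(-\frac{x'^2}{2\beta^2}\Big)\sum_{k\ge 0}\alpha_k(x)\,\frac{x'^{\delta-1+2k}}{C_{\delta-1+2k}\,\beta^{\delta-1+2k}},\qquad \alpha_k(x)=\exp\Big(-\frac{a^2x^2}{2\beta^2}\Big)\frac{1}{k!}\Big(\frac{a^2x^2}{2\beta^2}\Big)^k .$$ For a probability measure $\nu$ on $(0,\infty)$ set $\psi^{(\delta)}(\nu)=\nu P^{(\delta)}$, i.e. $\psi^{(\delta)}(\nu)(dx')=\big(\int_0^\infty\nu(dx)\,p^{(\delta)}(x,x')\big)dx'$. Then for every integer $i\ge 0$ and every $\sigma>0$, $$\psi^{(\delta)}\big(\nu^{i,(\delta)}_\sigma\big)=\sum_{k=0}^{i}\alpha_k^{(i,\sigma)}\,\nu^{k,(\delta)}_{\tau(\sigma)},$$ with $\tau(\sigma)>0$ given by $\tau^2(\sigma)=\beta^2+a^2\sigma^2$ and, for $k=0,1,\dots,i$, $$\alpha_k^{(i,\sigma)}=\binom{i}{k}\Big(1-\frac{\beta^2}{\tau^2(\sigma)}\Big)^{k}\Big(\frac{\beta^2}{\tau^2(\sigma)}\Big)^{i-k}.$$ Thus $\psi^{(\delta)}(\nu^{i,(\delta)}_\sigma)$ is a finite mixture of the measures $\nu^{k,(\delta)}_{\tau(\sigma)}$,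 $k\ge 0$, with parameter $\tau(\sigma)$ not depending on $i$, whose mixture parameter has length $L(i)=i$ (the largest index $k$ with $\alpha_k^{(i,\sigma)}>0$ is $i$).
   Context: For $\alpha\ge 0$, $C_\alpha=\mathbb E|X|^\alpha$ with $X$ a standard Gaussian random variable. For $i\ge 0$, $\sigma>0$, $$\nu^{i,(\delta)}_\sigma(dx)=1_{(x>0)}\frac{2}{\sigma(2\pi)^{1/2}}\,\frac{x^{\delta-1+2i}}{C_{\delta-1+2i}\,\sigma^{\delta-1+2i}}\exp\Big(-\frac{x^2}{2\sigma^2}\Big)dx,$$ which is a probability measure on $(0,\infty)$. Origin of the kernel (not needed to read the claim): $P^{(\delta)}$ is the transition operator of the chain $x_n=X_{n\Delta}$, where $X$ is the radial Ornstein–Uhlenbeck diffusion $dX_t=\big(\theta X_t+\frac{(\delta-1)\sigma_0^2}{2X_t}\big)dt+\sigma_0\,d\beta_t$, with $a=e^{\theta\Delta}$ and $\beta^2=\sigma_0^2\frac{e^{2\theta\Delta}-1}{2\theta}$; as $\theta\in\mathbb R$, $\sigma_0>0$, $\Delta>0$ vary, $(a,\beta)$ ranges over positive pairs. *)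

theory Defs
  imports "HOL-Probability.Probability"
begin

text \<open>
  A measure on \<open>(0, \<infinity>)\<close> is represented by a Borel measure on the real line whose density
  carries the indicator of \<open>{0<..}\<close>.
\<close>

text \<open>The value \<open>0 powr 0 = 0\<close> is harmless in the next definition: \<open>{0}\<close> is a null set.\<close>

definition gauss_abs_moment :: "real \<Rightarrow> real" where
  "gauss_abs_moment \<alpha> = (LINT x|density lborel std_normal_density. \<bar>x\<bar> powr \<alpha>)"

definition nu_density :: "real \<Rightarrow> nat \<Rightarrow> real \<Rightarrow> real \<Rightarrow> real" where
  "nu_density \<delta> i \<sigma> x =
     indicator {0<..} x * (2 / (\<sigma> * sqrt (2 * pi))) *
     (x powr (\<delta> - 1 + 2 * real i) /
       (gauss_abs_moment (\<delta> - 1 + 2 * real i) * \<sigma> powr (\<delta> - 1 + 2 * real i))) *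
     exp (- (x\<^sup>2 / (2 * \<sigma>\<^sup>2)))"

definition nu :: "real \<Rightarrow> nat \<Rightarrow> real \<Rightarrow> real measure" where
  "nu \<delta> i \<sigma> = density lborel (\<lambda>x. ennreal (nu_density \<delta> i \<sigma> x))"

definition poisson_coeff :: "real \<Rightarrow> real \<Rightarrow> nat \<Rightarrow> real \<Rightarrow> real" where
  "poisson_coeff a \<beta> k x =
     exp (- (a\<^sup>2 * x\<^sup>2 / (2 * \<beta>\<^sup>2))) * (1 / fact k) * (a\<^sup>2 * x\<^sup>2 / (2 * \<beta>\<^sup>2)) ^ k"

definition trans_density :: "real \<Rightarrow> real \<Rightarrow> real \<Rightarrow> real \<Rightarrow> real \<Rightarrow> real" where
  "trans_density \<delta> a \<beta> x x' =
     indicator {0<..} x' * (2 / (\<beta> * sqrt (2 * pi))) * exp (- (x'\<^sup>2 / (2 * \<beta>\<^sup>2))) *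
     (\<Sum>k. poisson_coeff a \<beta> k x *
        (x' powr (\<delta> - 1 + 2 * real k) /
          (gauss_abs_moment (\<delta> - 1 + 2 * real k) * \<beta> powr (\<delta> - 1 + 2 * real k))))"

definition psi :: "real \<Rightarrow> real \<Rightarrow> real \<Rightarrow> real measure \<Rightarrow> real measure" where
  "psi \<delta> a \<beta> \<nu> =
     density lborel (\<lambda>x'. \<integral>\<^sup>+ x\<in>{0<..}. ennreal (trans_density \<delta> a \<beta> x x') \<partial>\<nu>)"

definition tau :: "real \<Rightarrow> real \<Rightarrow> real \<Rightarrow> real" where
  "tau a \<beta> \<sigma> = sqrt (\<beta>\<^sup>2 + a\<^sup>2 * \<sigma>\<^sup>2)"

text \<open>
  Defined for all \<open>k\<close>: the binomial coefficient makes the sequence vanish for \<open>k > i\<close>, where the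
  truncated exponent \<open>i - k\<close> plays no role.
\<close>

definition mix_weight :: "real \<Rightarrow> real \<Rightarrow> real \<Rightarrow> nat \<Rightarrow> nat \<Rightarrow> real" where
  "mix_weight a \<beta> \<sigma> i k =
     real (i choose k) * (1 - \<beta>\<^sup>2 / (tau a \<beta> \<sigma>)\<^sup>2) ^ k * (\<beta>\<^sup>2 / (tau a \<beta> \<sigma>)\<^sup>2) ^ (i - k)"

text \<open>The setwise linear combination \<open>\<Sum>k\<in>K. w k \<cdot> \<mu> k\<close> of Borel measures (with \<open>w \<ge> 0\<close>).\<close>

definition measure_comb :: "nat set \<Rightarrow> (nat \<Rightarrow> real) \<Rightarrow> (nat \<Rightarrow> real measure) \<Rightarrow> real measure" where
  "measure_comb K w \<mu> =
     measure_of UNIV (sets borel) (\<lambda>A. \<Sum>k\<in>K. ennreal (w k) * emeasure (\<mu> k) A)"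

lemma sets_measure_comb [simp]: "sets (measure_comb K w \<mu>) = sets borel"
  unfolding measure_comb_def
  by (metis sets.sets_measure_of_eq space_borel)

lemma emeasure_measure_comb:
  assumes "\<And>k. k \<in> K \<Longrightarrow> sets (\<mu> k) = sets borel" and A: "A \<in> sets borel"
  shows "emeasure (measure_comb K w \<mu>) A = (\<Sum>k\<in>K. ennreal (w k) * emeasure (\<mu> k) A)"
  unfolding measure_comb_def
proof (rule emeasure_measure_of_sigma)
  show "sigma_algebra UNIV (sets (borel :: real measure))"
    by (metis sets.sigma_algebra_axioms space_borel)
  show "positive (sets borel) (\<lambda>A. \<Sum>k\<in>K. ennreal (w k) * emeasure (\<mu> k) A)"
    by (simp add: positive_def)
  show "countably_additive (sets borel) (\<lambda>A. \<Sum>k\<in>K. ennreal (w k) * emeasure (\<mu> k) A)"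
  proof (rule countably_additiveI)
    fix B :: "nat \<Rightarrow> real set"
    assume B: "range B \<subseteq> sets borel" "disjoint_family B"
    have "(\<Sum>n. \<Sum>k\<in>K. ennreal (w k) * emeasure (\<mu> k) (B n))
        = (\<Sum>k\<in>K. \<Sum>n. ennreal (w k) * emeasure (\<mu> k) (B n))"
      by (rule suminf_sum) simp
    also have "\<dots> = (\<Sum>k\<in>K. ennreal (w k) * emeasure (\<mu> k) (\<Union>n. B n))"
    proof (rule sum.cong[OF refl])
      fix k assume "k \<in> K"
      then show "(\<Sum>n. ennreal (w k) * emeasure (\<mu> k) (B n))
          = ennreal (w k) * emeasure (\<mu> k) (\<Union>n. B n)"
        using B assms(1) by (simp add: suminf_emeasure)
    qed
    finally show "(\<Sum>n. \<Sum>k\<in>K. ennreal (w k) * emeasure (\<mu> k) (B n))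
        = (\<Sum>k\<in>K. ennreal (w k) * emeasure (\<mu> k) (\<Union>n. B n))" .
  qed
qed (rule A)

definition mixture_param :: "(nat \<Rightarrow> real) \<Rightarrow> bool" where
  "mixture_param w \<longleftrightarrow>
     (\<forall>k. 0 \<le> w k) \<and> finite {k. w k \<noteq> 0} \<and> (\<Sum>k | w k \<noteq> 0. w k) = 1"

definition is_finite_mixture ::
    "(nat \<Rightarrow> real) \<Rightarrow> (nat \<Rightarrow> real measure) \<Rightarrow> real measure \<Rightarrow> bool" where
  "is_finite_mixture w \<mu> M \<longleftrightarrow> mixture_param w \<and> M = measure_comb {k. w k \<noteq> 0} w \<mu>"

text \<open>
  Meaningful only for a mixture parameter, where the set below is finite and nonempty.
\<close>

definition mixture_length :: "(nat \<Rightarrow> real) \<Rightarrow> nat" where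
  "mixture_length w = Max {k. 0 < w k}"

end

theory Submission
  imports Defs "HOL-Real_Asymp.Real_Asymp"
begin

text \<open>
  Integrating the Poisson weights against \<open>nu \<delta> i \<sigma>\<close> produces negative binomial weights. Together
  with \<open>C\<^bsub>\<alpha> + 2\<^esub> = (\<alpha> + 1) C\<^bsub>\<alpha>\<^esub>\<close> for the Gaussian moments, this turns the density of
  \<open>psi \<delta> a \<beta> (nu \<delta> i \<sigma>)\<close> into a multiple of the confluent hypergeometric series
  \<open>\<^sub>1F\<^sub>1(\<delta>/2 + i; \<delta>/2; z)\<close>, and Kummer's transformation, which makes it \<open>exp z\<close> times a polynomial
  of degree \<open>i\<close> in \<open>z\<close>, gives the finite mixture.
\<close>

section \<open>Rising factorials and the confluent hypergeometric series\<close>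

text \<open>
  Kummer's transformation: by Vandermonde's identity, the series is the Cauchy product of a
  polynomial with the exponential series.
\<close>

lemma kummer_sums:
  fixes b z :: real
  assumes "b > 0"
  shows "(\<lambda>k. pochhammer (b + real i) k / pochhammer b k * z ^ k / fact k) sums
    ((\<Sum>j\<le>i. real (i choose j) * z ^ j / pochhammer b j) * exp z)"
proof -
  define u where "u j = real (i choose j) * z ^ j / pochhammer b j" for j
  define v where "v k = z ^ k / fact k" for k :: nat
  have pos: "pochhammer b j > 0" for j
    using assms by (rule pochhammer_pos)
  have u0: "u j = 0" if "j \<notin> {..i}" for j
    using that by (simp add: u_def)
  have v_sums: "v sums exp z"
    using exp_converges[of z] by (simp add: v_def [abs_def] divide_inverse mult.commute)
  have "(\<lambda>k. \<Sum>j\<le>k. u j * v (k - j)) sums ((\<Sum>k. u k) * (\<Sum>k. v k))"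
  proof (rule Cauchy_product_sums)
    show "summable (\<lambda>k. norm (u k))"
      by (rule summable_finite[of "{..i}"]) (auto simp: u0)
    show "summable (\<lambda>k. norm (v k))"
      using summable_norm_exp[of z] by (simp add: v_def divide_inverse mult.commute)
  qed
  moreover have "(\<Sum>k. u k) = (\<Sum>j\<le>i. u j)"
    by (rule suminf_finite) (auto simp: u0)
  moreover have "(\<Sum>k. v k) = exp z"
    using v_sums by (rule sums_unique[symmetric])
  moreover have "(\<Sum>j\<le>k. u j * v (k - j)) = pochhammer (b + real i) k / pochhammer b k * z ^ k / fact k" for k
  proof -
    \<comment> \<open>As a generalized binomial coefficient, the rising factorial has top index
      \<open>b + real i + real k - 1\<close>, from which \<open>real i\<close> splits off as one of
      the two Vandermonde summands.\<close>
    have "pochhammer (b + real i) k / fact k = (real i + (b + real k - 1)) gchoose k"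
      by (simp add: gbinomial_pochhammer' algebra_simps)
    also have "\<dots> = (\<Sum>j\<le>k. (real i gchoose j) * ((b + real k - 1) gchoose (k - j)))"
      by (simp only: gbinomial_Vandermonde[symmetric] atLeast0AtMost)
    also have "\<dots> = (\<Sum>j\<le>k. real (i choose j) * (pochhammer b k / pochhammer b j / fact (k - j)))"
    proof (rule sum.cong[OF refl])
      fix j assume "j \<in> {..k}"
      then have j: "j \<le> k" by simp
      \<comment> \<open>The other Vandermonde factor consists of the last \<open>k - j\<close>
        factors of \<open>pochhammer b k\<close>, which explains the quotient.\<close>
      have "(b + real k - 1) gchoose (k - j) = pochhammer (b + real j) (k - j) / fact (k - j)"
        using j by (simp add: gbinomial_pochhammer' of_nat_diff algebra_simps)
      also have "pochhammer (b + real j) (k - j) = pochhammer b k / pochhammer b j"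
        using pochhammer_product[OF j, of b] pos[of j] by (simp add: field_simps)
      finally show "(real i gchoose j) * ((b + real k - 1) gchoose (k - j)) =
          real (i choose j) * (pochhammer b k / pochhammer b j / fact (k - j))"
        by (simp add: binomial_gbinomial)
    qed
    finally have "pochhammer (b + real i) k / fact k =
        (\<Sum>j\<le>k. real (i choose j) / (pochhammer b j * fact (k - j))) * pochhammer b k"
      by (simp add: sum_distrib_right)
    then have "pochhammer (b + real i) k / pochhammer b k * z ^ k / fact k =
        (\<Sum>j\<le>k. real (i choose j) / (pochhammer b j * fact (k - j))) * z ^ k"
      using pos[of k] by (simp add: field_simps)
    also have "\<dots> = (\<Sum>j\<le>k. u j * v (k - j))"
      unfolding sum_distrib_right
      by (rule sum.cong) (auto simp: u_def v_def simp flip: power_add)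
    finally show ?thesis by simp
  qed
  ultimately show ?thesis by (simp add: u_def)
qed

text \<open>Each factor \<open>b + j\<close> of the rising factorial is at least \<open>b\<close>.
  The bound serves to dominate the kernel series by an exponential series.\<close>

lemma pochhammer_ge_power:
  fixes b :: real
  assumes "b > 0"
  shows "b ^ k \<le> pochhammer b k"
proof (induction k)
  case (Suc k)
  then show ?case
    using assms mult_mono[of "b ^ k" "pochhammer b k" b "b + real k"]
    by (simp add: pochhammer_Suc mult.commute pochhammer_nonneg)
qed simp

section \<open>Absolute moments of the standard Gaussian\<close>

text \<open>Reduces real exponents to natural ones: |x| to the power \<open>\<alpha>\<close> is at
  most 1 on [-1, 1], and at most \<open>\<bar>x\<bar> ^ n\<close> elsewhere for a natural
  \<open>n \<ge> \<alpha>\<close>.\<close>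

lemma integrable_std_normal_abs_powr:
  assumes "\<alpha> \<ge> 0"
  shows "integrable lborel (\<lambda>x. std_normal_density x * \<bar>x\<bar> powr \<alpha>)"
proof -
  obtain n :: nat where n: "\<alpha> \<le> real n"
    using real_arch_simple by blast
  show ?thesis
  proof (rule Bochner_Integration.integrable_bound)
    show "integrable lborel (\<lambda>x. std_normal_density x + std_normal_density x * \<bar>x\<bar> ^ n)"
      by (intro Bochner_Integration.integrable_add integrable_std_normal_moment_abs) simp
    have "\<bar>x\<bar> powr \<alpha> \<le> 1 + \<bar>x\<bar> ^ n" for x :: real
    proof (cases "\<bar>x\<bar> \<le> 1")
      case True
      then have "\<bar>x\<bar> powr \<alpha> \<le> 1"
        using assms by (simp add: powr_le1)
      then show ?thesis
        by (simp add: add_increasing2)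
    next
      case False
      then have "\<bar>x\<bar> powr \<alpha> \<le> \<bar>x\<bar> powr real n"
        using n by (intro powr_mono) auto
      also have "\<dots> = \<bar>x\<bar> ^ n"
        using False by (subst powr_realpow) auto
      finally show ?thesis by simp
    qed
    then have "std_normal_density x * \<bar>x\<bar> powr \<alpha> \<le> std_normal_density x * (1 + \<bar>x\<bar> ^ n)" for x
      by (intro mult_left_mono) auto
    then show "AE x in lborel. norm (std_normal_density x * \<bar>x\<bar> powr \<alpha>)
        \<le> norm (std_normal_density x + std_normal_density x * \<bar>x\<bar> ^ n)"
      by (auto simp: abs_mult distrib_left intro!: AE_I2)
  qed simp
qed

lemma gauss_abs_moment_eq:
  "gauss_abs_moment \<alpha> = (LINT x|lborel. std_normal_density x * \<bar>x\<bar> powr \<alpha>)"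
  unfolding gauss_abs_moment_def by (subst integral_density) auto

text \<open>A nonnegative integrand with integral 0 vanishes almost everywhere. Strict positivity
  allows the moments to be cancelled from denominators.\<close>

lemma gauss_abs_moment_pos:
  assumes "\<alpha> \<ge> 0"
  shows "gauss_abs_moment \<alpha> > 0"
proof -
  have "gauss_abs_moment \<alpha> \<noteq> 0"
  proof
    assume "gauss_abs_moment \<alpha> = 0"
    then have "AE x in lborel. std_normal_density x * \<bar>x\<bar> powr \<alpha> = 0"
      unfolding gauss_abs_moment_eq
      using integral_nonneg_eq_0_iff_AE[OF integrable_std_normal_abs_powr[OF assms]] by auto
    \<comment> \<open>The density is positive and \<open>powr\<close> vanishes only at base 0, also
      for exponent 0.\<close>
    then have "AE x in lborel. x = (0::real)"
      by eventually_elim (auto simp: less_imp_neq[OF normal_density_pos, symmetric])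
    then have "AE x in (lborel :: real measure). False"
      using AE_lborel_singleton[of "0::real"] by eventually_elim auto
    then show False
      by (simp add: AE_iff_null null_sets_def)
  qed
  moreover have "gauss_abs_moment \<alpha> \<ge> 0"
    unfolding gauss_abs_moment_eq by (intro integral_nonneg_AE) auto
  ultimately show ?thesis by simp
qed

text \<open>The integrand of the moment is even, so the half-line carries half of it;
  \<open>sqrt (2 * pi)\<close> undoes the normalization of the Gaussian density.\<close>

lemma has_bochner_integral_half_gauss:
  assumes "\<alpha> \<ge> 0"
  shows "has_bochner_integral lborel (\<lambda>x. indicator {0<..} x * (x powr \<alpha> * exp (- (x\<^sup>2 / 2))))
    (sqrt (2 * pi) / 2 * gauss_abs_moment \<alpha>)"
proof -
  let ?f = "\<lambda>x. std_normal_density x * \<bar>x\<bar> powr \<alpha>"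
  let ?g = "\<lambda>x. indicator {0..} x *\<^sub>R ?f x"
  have g: "integrable lborel ?g"
    by (intro integrable_mult_indicator integrable_std_normal_abs_powr assms) auto
  have "has_bochner_integral lborel ?f (2 *\<^sub>R integral\<^sup>L lborel ?g)"
    by (rule has_bochner_integral_even_function)
       (use g[THEN has_bochner_integral_integrable] in \<open>simp_all only: std_normal_density_def abs_minus_cancel power2_minus\<close>)
  then have "gauss_abs_moment \<alpha> = 2 * integral\<^sup>L lborel ?g"
    by (simp add: gauss_abs_moment_eq has_bochner_integral_iff)
  with g have "has_bochner_integral lborel ?g (gauss_abs_moment \<alpha> / 2)"
    by (simp add: has_bochner_integral_iff)
  then have "has_bochner_integral lborel (\<lambda>x. sqrt (2 * pi) * ?g x) (sqrt (2 * pi) * (gauss_abs_moment \<alpha> / 2))"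
    by (rule has_bochner_integral_mult_right) 
  \<comment> \<open>The indicators of the closed and the open half-line differ only at 0, where
    \<open>0 powr \<alpha> = 0\<close> makes both sides vanish.\<close>
  moreover have "(\<lambda>x. sqrt (2 * pi) * ?g x) =
      (\<lambda>x. indicator {0<..} x * (x powr \<alpha> * exp (- (x\<^sup>2 / 2))))"
    by (auto simp: fun_eq_iff std_normal_density_def indicator_def)
  ultimately show ?thesis by simp
qed

text \<open>Integration by parts: \<open>?f\<close> is the derivative of \<open>?F\<close>, which
  tends to 0 both at 0, because \<open>\<alpha> + 1 > 0\<close>, and at infinity. Hence
  \<open>?f\<close> integrates to 0 over the half-line.\<close>

lemma gauss_abs_moment_add_2:
  assumes "\<alpha> \<ge> 0"
  shows "gauss_abs_moment (\<alpha> + 2) = (\<alpha> + 1) * gauss_abs_moment \<alpha>"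
proof -
  let ?h = "\<lambda>\<alpha> x::real. x powr \<alpha> * exp (- (x\<^sup>2 / 2))"
  let ?F = "\<lambda>x::real. x powr (\<alpha> + 1) * exp (- (x\<^sup>2 / 2))"
  let ?f = "\<lambda>x::real. (\<alpha> + 1) * ?h \<alpha> x - ?h (\<alpha> + 2) x"
  have ein: "einterval 0 \<infinity> = {0<..}"
    by (auto simp: einterval_def)
  have I: "has_bochner_integral lborel (\<lambda>x. indicator {0<..} x *\<^sub>R ?f x)
     ((\<alpha> + 1) * (sqrt (2 * pi) / 2 * gauss_abs_moment \<alpha>) - sqrt (2 * pi) / 2 * gauss_abs_moment (\<alpha> + 2))"
    using has_bochner_integral_diff[OF has_bochner_integral_mult_right[OF has_bochner_integral_half_gauss[OF assms], of "\<alpha> + 1"]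
       has_bochner_integral_half_gauss[of "\<alpha> + 2"]] assms
    by (simp add: algebra_simps)
  have "(LBINT x=0..\<infinity>. ?f x) = 0 - 0"
  proof (rule interval_integral_FTC_integrable)
    fix x :: real assume "0 < ereal x"
    then have x: "x > 0" by simp
    have e: "x powr (\<alpha> + 2) = x powr (\<alpha> + 1) * x"
      using x by (simp add: powr_add power2_eq_square)
    show "(?F has_vector_derivative ?f x) (at x)"
      unfolding has_real_derivative_iff_has_vector_derivative[symmetric]
      by (rule derivative_eq_intros refl x | simp add: e x algebra_simps)+
    show "isCont ?f x"
      using x by (intro continuous_intros) auto
  next
    show "set_integrable lborel (einterval 0 \<infinity>) ?f"
      using I by (simp add: set_integrable_def ein has_bochner_integral_iff)
    have "(?F \<longlongrightarrow> 0 powr (\<alpha> + 1) * exp (- (0\<^sup>2 / 2))) (at_right 0)"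
      using assms by (intro tendsto_intros) (auto simp: eventually_at_filter)
    then show "((?F \<circ> real_of_ereal) \<longlongrightarrow> 0) (at_right 0)"
      by (simp add: zero_ereal_def ereal_tendsto_simps)
    have "(?F \<longlongrightarrow> 0) at_top"
      by real_asymp
    then show "((?F \<circ> real_of_ereal) \<longlongrightarrow> 0) (at_left \<infinity>)"
      by (simp add: ereal_tendsto_simps)
  qed simp
  also have "(LBINT x=0..\<infinity>. ?f x) = integral\<^sup>L lborel (\<lambda>x. indicator {0<..} x *\<^sub>R ?f x)"
    by (simp add: interval_lebesgue_integral_def ein set_lebesgue_integral_def)
  finally have "sqrt (2 * pi) / 2 * ((\<alpha> + 1) * gauss_abs_moment \<alpha> - gauss_abs_moment (\<alpha> + 2)) = 0"
    using I by (simp add: has_bochner_integral_iff algebra_simps)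
  then show ?thesis by simp
qed

text \<open>Iterating the recurrence gives the product of the factors
  \<open>\<alpha> + 1 + 2 * j\<close> for \<open>j < k\<close>; taking a 2 out of each leaves a
  Pochhammer symbol.\<close>

lemma gauss_abs_moment_add_even:
  assumes "\<alpha> \<ge> 0"
  shows "gauss_abs_moment (\<alpha> + 2 * real k) =
    gauss_abs_moment \<alpha> * 2 ^ k * pochhammer ((\<alpha> + 1) / 2) k"
proof (induction k)
  case (Suc k)
  have "gauss_abs_moment (\<alpha> + 2 * real (Suc k)) = gauss_abs_moment ((\<alpha> + 2 * real k) + 2)"
    by (simp add: algebra_simps)
  also have "\<dots> = (\<alpha> + 2 * real k + 1) * gauss_abs_moment (\<alpha> + 2 * real k)"
    using assms by (intro gauss_abs_moment_add_2) simp
  finally show ?case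
    unfolding Suc.IH by (simp add: pochhammer_Suc field_simps)
qed simp

text \<open>Substituting \<open>\<rho> * x\<close> for \<open>x\<close> reduces to unit variance;
  the extra power of \<open>\<rho>\<close> is the Jacobian.\<close>

lemma nn_integral_half_gauss_scaled:
  assumes "\<alpha> \<ge> 0" "\<rho> > 0"
  shows "(\<integral>\<^sup>+x. ennreal (indicator {0<..} x * (x powr \<alpha> * exp (- (x\<^sup>2 / (2 * \<rho>\<^sup>2))))) \<partial>lborel) =
    ennreal (\<rho> powr (\<alpha> + 1) * (sqrt (2 * pi) / 2 * gauss_abs_moment \<alpha>))"
proof -
  let ?h = "\<lambda>x. indicator {0<..} x * (x powr \<alpha> * exp (- (x\<^sup>2 / 2))) :: real"
  have "(\<integral>\<^sup>+x. ennreal (indicator {0<..} x * (x powr \<alpha> * exp (- (x\<^sup>2 / (2 * \<rho>\<^sup>2))))) \<partial>lborel) =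
    ennreal \<bar>\<rho>\<bar> * (\<integral>\<^sup>+x. ennreal (indicator {0<..} (0 + \<rho> * x) * ((0 + \<rho> * x) powr \<alpha> * exp (- ((0 + \<rho> * x)\<^sup>2 / (2 * \<rho>\<^sup>2))))) \<partial>lborel)"
    using assms by (intro nn_integral_real_affine) auto
  also have "(\<lambda>x. ennreal (indicator {0<..} (0 + \<rho> * x) * ((0 + \<rho> * x) powr \<alpha> * exp (- ((0 + \<rho> * x)\<^sup>2 / (2 * \<rho>\<^sup>2)))))) =
    (\<lambda>x. ennreal (\<rho> powr \<alpha>) * ennreal (?h x))"
    using assms
    by (auto simp: fun_eq_iff indicator_def powr_mult power_mult_distrib zero_less_mult_iff ennreal_mult'[symmetric] mult.assoc)
  also have "(\<integral>\<^sup>+x. ennreal (\<rho> powr \<alpha>) * ennreal (?h x) \<partial>lborel) =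
      ennreal (\<rho> powr \<alpha>) * (\<integral>\<^sup>+x. ennreal (?h x) \<partial>lborel)"
    by (rule nn_integral_cmult) simp
  also have "(\<integral>\<^sup>+x. ennreal (?h x) \<partial>lborel) = ennreal (sqrt (2 * pi) / 2 * gauss_abs_moment \<alpha>)"
    using has_bochner_integral_half_gauss[OF assms(1)]
    by (subst nn_integral_eq_integral) (simp_all only: has_bochner_integral_iff, auto)
  finally show ?thesis
    using assms gauss_abs_moment_pos[OF assms(1)]
    by (simp add: ennreal_mult'[symmetric] powr_add mult_ac)
qed


section \<open>Densities of \<open>nu\<close> and of the transition kernel\<close>

lemma nu_density_nonneg:
  assumes "\<delta> \<ge> 1" "\<sigma> > 0"
  shows "nu_density \<delta> i \<sigma> x \<ge> 0"
  using assms gauss_abs_moment_pos[of "\<delta> - 1 + 2 * real i"]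
  by (simp add: nu_density_def)

lemma nu_density_measurable [measurable]: "nu_density \<delta> i \<sigma> \<in> borel_measurable borel"
  unfolding nu_density_def [abs_def] by measurable

text \<open>Isolates the dependence on \<open>k\<close>. The Pochhammer symbol comes from the moment
  in the normalization and becomes the lower parameter \<open>\<delta> / 2\<close> of the
  hypergeometric series.\<close>

lemma nu_density_eq:
  assumes "\<delta> \<ge> 1" "\<sigma> > 0"
  shows "nu_density \<delta> k \<sigma> y = nu_density \<delta> 0 \<sigma> y * (y\<^sup>2 / (2 * \<sigma>\<^sup>2)) ^ k / pochhammer (\<delta> / 2) k"
proof (cases "y > 0")
  case True
  have "y powr (\<delta> - 1 + 2 * real k) = y powr (\<delta> - 1) * (y\<^sup>2) ^ k"
    using True powr_realpow[of y "2 * k"] by (simp add: powr_add power_mult)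
  moreover have "\<sigma> powr (\<delta> - 1 + 2 * real k) = \<sigma> powr (\<delta> - 1) * (\<sigma>\<^sup>2) ^ k"
    using assms powr_realpow[of \<sigma> "2 * k"] by (simp add: powr_add power_mult)
  moreover have "gauss_abs_moment (\<delta> - 1 + 2 * real k) =
      gauss_abs_moment (\<delta> - 1) * 2 ^ k * pochhammer (\<delta> / 2) k"
    using gauss_abs_moment_add_even[of "\<delta> - 1" k] assms by simp
  ultimately show ?thesis
    by (simp add: nu_density_def power_divide power_mult_distrib mult_ac)
qed (simp add: nu_density_def)

lemma poisson_coeff_nonneg: "poisson_coeff a \<beta> k x \<ge> 0"
  by (simp add: poisson_coeff_def)

lemma poisson_coeff_measurable [measurable]: "poisson_coeff a \<beta> k \<in> borel_measurable borel"
  unfolding poisson_coeff_def [abs_def] by measurable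

lemma trans_density_measurable [measurable]: "(\<lambda>x. trans_density \<delta> a \<beta> x y) \<in> borel_measurable borel"
  unfolding trans_density_def [abs_def] by measurable

text \<open>Convergence is the point, since the infinite sum in \<open>trans_density\<close> has its
  intended value only for a summable series. Bounding \<open>pochhammer (\<delta> / 2) k\<close>
  below by a power gives an exponential majorant.\<close>

lemma trans_density_sums:
  assumes "\<delta> \<ge> 1" "\<beta> > 0"
  shows "(\<lambda>k. poisson_coeff a \<beta> k x * nu_density \<delta> k \<beta> y) sums trans_density \<delta> a \<beta> x y"
proof (cases "y > 0")
  case True
  define w where "w = a\<^sup>2 * x\<^sup>2 / (2 * \<beta>\<^sup>2)"
  define z where "z = y\<^sup>2 / (2 * \<beta>\<^sup>2)"
  define c where "c = 2 / (\<beta> * sqrt (2 * pi)) * exp (- (y\<^sup>2 / (2 * \<beta>\<^sup>2)))"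
  let ?r = "\<lambda>k. poisson_coeff a \<beta> k x * (y powr (\<delta> - 1 + 2 * real k) /
          (gauss_abs_moment (\<delta> - 1 + 2 * real k) * \<beta> powr (\<delta> - 1 + 2 * real k)))"
  have c: "c > 0"
    using assms by (simp add: c_def)
  have eq: "poisson_coeff a \<beta> k x * nu_density \<delta> k \<beta> y = c * ?r k" for k
    using True by (simp add: nu_density_def c_def)
  have "summable (\<lambda>k. poisson_coeff a \<beta> k x * nu_density \<delta> k \<beta> y)"
  proof (rule summable_comparison_test'[where N = 0])
    have "summable (\<lambda>k. inverse (fact k) * (w * z / (\<delta> / 2)) ^ k)"
      by (rule summable_exp)
    then show "summable (\<lambda>k. exp (- w) * nu_density \<delta> 0 \<beta> y * (inverse (fact k) * (w * z / (\<delta> / 2)) ^ k))"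
      by (rule summable_mult)
    fix k :: nat
    have b: "\<delta> / 2 > 0"
      using assms by simp
    have "poisson_coeff a \<beta> k x * nu_density \<delta> k \<beta> y =
        exp (- w) * nu_density \<delta> 0 \<beta> y * (inverse (fact k) * ((w * z) ^ k / pochhammer (\<delta> / 2) k))"
    proof -
      have "poisson_coeff a \<beta> k x = exp (- w) * inverse (fact k) * w ^ k"
        by (simp add: poisson_coeff_def w_def inverse_eq_divide)
      then show ?thesis
        unfolding nu_density_eq[OF assms, of k] z_def[symmetric]
        by (simp add: power_mult_distrib mult_ac)
    qed
    also have "\<dots> \<le> exp (- w) * nu_density \<delta> 0 \<beta> y * (inverse (fact k) * ((w * z) ^ k / (\<delta> / 2) ^ k))"
      using b nu_density_nonneg[OF assms, of 0 y] pochhammer_ge_power[OF b, of k]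
      by (intro mult_left_mono divide_left_mono mult_pos_pos pochhammer_pos)
         (auto simp: w_def z_def)
    finally show "norm (poisson_coeff a \<beta> k x * nu_density \<delta> k \<beta> y)
        \<le> exp (- w) * nu_density \<delta> 0 \<beta> y * (inverse (fact k) * (w * z / (\<delta> / 2)) ^ k)"
      using nu_density_nonneg[OF assms, of k y] poisson_coeff_nonneg[of a \<beta> k x]
      by (simp add: power_divide)
  qed
  \<comment> \<open>As \<open>c\<close> is nonzero, summability passes to the series in the form
    used by \<open>trans_density\<close>.\<close>
  then have "summable ?r"
    using c unfolding eq summable_cmult_iff by simp
  then have "(\<lambda>k. c * ?r k) sums (c * (\<Sum>k. ?r k))"
    by (intro sums_mult summable_sums)
  moreover have "c * (\<Sum>k. ?r k) = trans_density \<delta> a \<beta> x y"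
    using True by (simp add: trans_density_def c_def)
  ultimately show ?thesis
    by (simp add: eq)
qed (simp add: nu_density_def trans_density_def)

section \<open>Poisson weights: integration against \<open>nu\<close> and resummation\<close>

lemma tau_pos: "\<beta> > 0 \<Longrightarrow> tau a \<beta> \<sigma> > 0"
  by (simp add: tau_def add_pos_nonneg)

lemma tau_sq: "(tau a \<beta> \<sigma>)\<^sup>2 = \<beta>\<^sup>2 + a\<^sup>2 * \<sigma>\<^sup>2"
  by (simp add: tau_def)

text \<open>The two Gaussian exponentials merge into one of scale \<open>\<rho>\<close>, leaving a
  half-line moment of order \<open>e + 2 * real k\<close>. Its ratio to the moment of order
  \<open>e\<close> in the normalization is \<open>2 ^ k\<close> times the Pochhammer symbol.\<close>

lemma nn_integral_poisson_nu:
  fixes a \<beta> \<sigma> :: real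
  assumes "\<delta> \<ge> 1" "\<beta> > 0" "\<sigma> > 0"
  defines "\<tau> \<equiv> tau a \<beta> \<sigma>"
  shows "(\<integral>\<^sup>+x. ennreal (nu_density \<delta> i \<sigma> x * poisson_coeff a \<beta> k x) \<partial>lborel) =
    ennreal ((\<beta> / \<tau>) powr (\<delta> + 2 * real i) *
      (1 - \<beta>\<^sup>2 / \<tau>\<^sup>2) ^ k * pochhammer (\<delta> / 2 + real i) k / fact k)"
proof -
  define e where "e = \<delta> - 1 + 2 * real i"
  \<comment> \<open>Chosen so that \<open>1 / \<rho>\<^sup>2 = 1 / \<sigma>\<^sup>2 + a\<^sup>2 /
    \<beta>\<^sup>2\<close>, the sum of the two precisions.\<close>
  define \<rho> where "\<rho> = \<sigma> * (\<beta> / \<tau>)"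
  define c where "c = 2 / (\<sigma> * sqrt (2 * pi)) / (gauss_abs_moment e * \<sigma> powr e) *
    ((a\<^sup>2 / (2 * \<beta>\<^sup>2)) ^ k / fact k)"
  have \<tau>: "\<tau> > 0" "\<tau>\<^sup>2 = \<beta>\<^sup>2 + a\<^sup>2 * \<sigma>\<^sup>2"
    unfolding \<tau>_def using assms by (simp_all add: tau_pos tau_sq)
  have e: "e \<ge> 0"
    using assms by (simp add: e_def)
  have C: "gauss_abs_moment e > 0"
    using e by (rule gauss_abs_moment_pos)
  have c: "c \<ge> 0"
    using C assms by (simp add: c_def)
  have \<rho>: "\<rho> > 0"
    using assms \<tau> by (simp add: \<rho>_def)
  have inv\<rho>: "x\<^sup>2 / (2 * \<sigma>\<^sup>2) + a\<^sup>2 * x\<^sup>2 / (2 * \<beta>\<^sup>2) = x\<^sup>2 / (2 * \<rho>\<^sup>2)" for x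
    using assms(2,3) \<tau>(1)
    by (simp add: \<rho>_def power_mult_distrib power_divide field_simps) (simp add: \<tau>(2) algebra_simps)
  have "nu_density \<delta> i \<sigma> x * poisson_coeff a \<beta> k x =
      c * (indicator {0<..} x * (x powr (e + 2 * real k) * exp (- (x\<^sup>2 / (2 * \<rho>\<^sup>2)))))" for x
  proof (cases "x > 0")
    case True
    have "x powr (e + 2 * real k) = x powr e * (x\<^sup>2) ^ k"
      using True powr_realpow[of x "2 * k"] by (simp add: powr_add power_mult)
    moreover have "exp (- (x\<^sup>2 / (2 * \<rho>\<^sup>2))) =
        exp (- (x\<^sup>2 / (2 * \<sigma>\<^sup>2))) * exp (- (a\<^sup>2 * x\<^sup>2 / (2 * \<beta>\<^sup>2)))"
      by (simp flip: exp_add inv\<rho>)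
    moreover have "(a\<^sup>2 * x\<^sup>2 / (2 * \<beta>\<^sup>2)) ^ k = (a\<^sup>2 / (2 * \<beta>\<^sup>2)) ^ k * (x\<^sup>2) ^ k"
      by (simp flip: power_mult_distrib)
    ultimately show ?thesis
      using True by (simp add: nu_density_def poisson_coeff_def c_def e_def mult_ac)
  qed (simp add: nu_density_def)
  then have "(\<integral>\<^sup>+x. ennreal (nu_density \<delta> i \<sigma> x * poisson_coeff a \<beta> k x) \<partial>lborel) =
      (\<integral>\<^sup>+x. ennreal c * ennreal (indicator {0<..} x *
        (x powr (e + 2 * real k) * exp (- (x\<^sup>2 / (2 * \<rho>\<^sup>2))))) \<partial>lborel)"
    using c by (simp add: ennreal_mult'[symmetric])
  also have "\<dots> = ennreal c * (\<integral>\<^sup>+x. ennreal (indicator {0<..} x *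
      (x powr (e + 2 * real k) * exp (- (x\<^sup>2 / (2 * \<rho>\<^sup>2))))) \<partial>lborel)"
    by (rule nn_integral_cmult) simp
  also have "\<dots> = ennreal c * ennreal (\<rho> powr (e + 2 * real k + 1) *
      (sqrt (2 * pi) / 2 * gauss_abs_moment (e + 2 * real k)))"
    using e \<rho> by (subst nn_integral_half_gauss_scaled) simp_all
  also have "\<dots> = ennreal (c * (\<rho> powr (e + 2 * real k + 1) *
      (sqrt (2 * pi) / 2 * gauss_abs_moment (e + 2 * real k))))"
    using c by (rule ennreal_mult'[symmetric])
  also have "c * (\<rho> powr (e + 2 * real k + 1) *
      (sqrt (2 * pi) / 2 * gauss_abs_moment (e + 2 * real k))) =
      (\<beta> / \<tau>) powr (\<delta> + 2 * real i) *
      (1 - \<beta>\<^sup>2 / \<tau>\<^sup>2) ^ k * pochhammer (\<delta> / 2 + real i) k / fact k"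
  proof -
    define A where "A = (a\<^sup>2 / (2 * \<beta>\<^sup>2)) ^ k"
    have "\<rho> powr (e + 2 * real k + 1) = \<rho> powr (e + 1) * (\<rho>\<^sup>2) ^ k"
      using \<rho> powr_realpow[of \<rho> "2 * k"] by (simp add: powr_add power_mult)
    also have "\<rho> powr (e + 1) = \<sigma> powr e * \<sigma> * (\<beta> / \<tau>) powr (\<delta> + 2 * real i)"
    proof -
      have "\<rho> powr (e + 1) = \<sigma> powr (e + 1) * (\<beta> / \<tau>) powr (e + 1)"
        unfolding \<rho>_def by (rule powr_mult)
      moreover have "\<sigma> powr (e + 1) = \<sigma> powr e * \<sigma>"
        using assms(3) by (simp add: powr_add)
      moreover have "e + 1 = \<delta> + 2 * real i"
        by (simp add: e_def)
      ultimately show ?thesis by simp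
    qed
    finally have "c * (\<rho> powr (e + 2 * real k + 1) *
        (sqrt (2 * pi) / 2 * gauss_abs_moment (e + 2 * real k))) =
        (\<beta> / \<tau>) powr (\<delta> + 2 * real i) * (A * (\<rho>\<^sup>2) ^ k * 2 ^ k) *
        pochhammer ((e + 1) / 2) k / fact k"
      unfolding gauss_abs_moment_add_even[OF e]
      unfolding c_def A_def[symmetric] using C assms(3) by simp
    \<comment> \<open>The \<open>2 ^ k\<close> from the moment cancels the 2 in the Poisson
      parameter, which leaves the \<open>k\<close>-th power of
      \<open>a\<^sup>2 * \<sigma>\<^sup>2 / \<tau>\<^sup>2\<close>.\<close>
    also have "A * (\<rho>\<^sup>2) ^ k * 2 ^ k = (1 - \<beta>\<^sup>2 / \<tau>\<^sup>2) ^ k"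
    proof -
      have "\<tau>\<^sup>2 > 0"
        using \<tau>(1) by simp
      then have "1 - \<beta>\<^sup>2 / \<tau>\<^sup>2 = (\<tau>\<^sup>2 - \<beta>\<^sup>2) / \<tau>\<^sup>2"
        by (simp add: diff_divide_distrib)
      also have "\<tau>\<^sup>2 - \<beta>\<^sup>2 = a\<^sup>2 * \<sigma>\<^sup>2"
        by (simp add: \<tau>(2))
      also have "a\<^sup>2 * \<sigma>\<^sup>2 / \<tau>\<^sup>2 = a\<^sup>2 / (2 * \<beta>\<^sup>2) * \<rho>\<^sup>2 * 2"
        using assms(2) by (simp add: \<rho>_def power_mult_distrib power_divide)
      finally show ?thesis
        by (simp only: A_def power_mult_distrib)
    qed
    also have "(e + 1) / 2 = \<delta> / 2 + real i"
      by (simp add: e_def)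
    finally show ?thesis .
  qed
  finally show ?thesis .
qed

text \<open>The exponential produced by Kummer's transformation is exactly what changes the scale of
  the base density from \<open>\<beta>\<close> to \<open>\<tau>\<close>.\<close>

lemma nu_density_0_scale:
  assumes "\<beta> > 0" "\<tau> > 0"
  shows "(\<beta> / \<tau>) powr \<delta> * nu_density \<delta> 0 \<beta> y * exp ((1 - \<beta>\<^sup>2 / \<tau>\<^sup>2) * (y\<^sup>2 / (2 * \<beta>\<^sup>2))) =
    nu_density \<delta> 0 \<tau> y"
proof -
  have "- (y\<^sup>2 / (2 * \<beta>\<^sup>2)) + (1 - \<beta>\<^sup>2 / \<tau>\<^sup>2) * (y\<^sup>2 / (2 * \<beta>\<^sup>2)) = - (y\<^sup>2 / (2 * \<tau>\<^sup>2))"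
    using assms by (simp add: field_simps)
  then have "exp (- (y\<^sup>2 / (2 * \<beta>\<^sup>2))) * exp ((1 - \<beta>\<^sup>2 / \<tau>\<^sup>2) * (y\<^sup>2 / (2 * \<beta>\<^sup>2))) =
      exp (- (y\<^sup>2 / (2 * \<tau>\<^sup>2)))"
    by (simp flip: exp_add)
  moreover have "(\<beta> / \<tau>) powr \<delta> = (\<beta> powr (\<delta> - 1) * \<beta>) / (\<tau> powr (\<delta> - 1) * \<tau>)"
    using assms by (simp add: powr_divide powr_diff)
  moreover define K where
    "K = indicator {0<..} y * 2 / sqrt (2 * pi) * y powr (\<delta> - 1) / gauss_abs_moment (\<delta> - 1)"
  have "nu_density \<delta> 0 \<sigma> y = K / (\<sigma> powr (\<delta> - 1) * \<sigma>) * exp (- (y\<^sup>2 / (2 * \<sigma>\<^sup>2)))" for \<sigma>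
    by (simp add: nu_density_def K_def)
  \<comment> \<open>The cancellation in abstract form: \<open>P\<close> and \<open>T\<close> stand
    for the powers of \<open>\<beta>\<close> and \<open>\<tau>\<close>, \<open>E\<close> and
    \<open>E'\<close> for the two exponentials.\<close>
  moreover have "P / T * (K / P * E) * E' = K / T * (E * E')" if "P \<noteq> 0" for P T E E' :: real
    using that by simp
  moreover have "\<beta> powr (\<delta> - 1) * \<beta> \<noteq> 0"
    using assms by simp
  ultimately show ?thesis
    by metis
qed

text \<open>Up to the constant \<open>c\<close>, this is the series of \<open>kummer_sums\<close>
  with lower parameter \<open>\<delta> / 2\<close> at \<open>z\<close>. The factor
  \<open>exp z\<close> rescales the base density, and each monomial of the polynomial yields one
  mixture component.\<close>

lemma negbinomial_mixture_sums:
  fixes a \<beta> \<sigma> :: real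
  assumes "\<delta> \<ge> 1" "\<beta> > 0"
  defines "\<tau> \<equiv> tau a \<beta> \<sigma>"
  shows "(\<lambda>k. (\<beta> / \<tau>) powr (\<delta> + 2 * real i) *
      (1 - \<beta>\<^sup>2 / \<tau>\<^sup>2) ^ k * pochhammer (\<delta> / 2 + real i) k / fact k * nu_density \<delta> k \<beta> y)
    sums (\<Sum>j\<le>i. mix_weight a \<beta> \<sigma> i j * nu_density \<delta> j \<tau> y)"
proof -
  define p where "p = 1 - \<beta>\<^sup>2 / \<tau>\<^sup>2"
  define z where "z = p * (y\<^sup>2 / (2 * \<beta>\<^sup>2))"
  define c where "c = (\<beta> / \<tau>) powr (\<delta> + 2 * real i) * nu_density \<delta> 0 \<beta> y"
  have \<tau>: "\<tau> > 0"
    using assms by (simp add: tau_pos)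
  have term_eq: "(\<beta> / \<tau>) powr (\<delta> + 2 * real i) * p ^ k * pochhammer (\<delta> / 2 + real i) k / fact k *
      nu_density \<delta> k \<beta> y =
      c * (pochhammer (\<delta> / 2 + real i) k / pochhammer (\<delta> / 2) k * z ^ k / fact k)" for k
    unfolding nu_density_eq[OF assms(1,2), of k]
    by (simp only: c_def z_def power_mult_distrib) (simp add: mult_ac)
  have "c * ((\<Sum>j\<le>i. real (i choose j) * z ^ j / pochhammer (\<delta> / 2) j) * exp z) =
      (\<Sum>j\<le>i. mix_weight a \<beta> \<sigma> i j * nu_density \<delta> j \<tau> y)"
  proof -
    have "(\<beta> / \<tau>) powr (\<delta> + 2 * real i) = (\<beta> / \<tau>) powr \<delta> * (\<beta>\<^sup>2 / \<tau>\<^sup>2) ^ i"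
      using \<tau> assms powr_realpow[of "\<beta> / \<tau>" "2 * i"]
      by (simp add: powr_add power_mult power_divide)
    then have c: "c * exp z = nu_density \<delta> 0 \<tau> y * (\<beta>\<^sup>2 / \<tau>\<^sup>2) ^ i"
      unfolding nu_density_0_scale[OF assms(2) \<tau>, symmetric] c_def z_def p_def
      by (simp only: mult_ac)
    \<comment> \<open>Of the \<open>i\<close> factors
      \<open>\<beta>\<^sup>2 / \<tau>\<^sup>2\<close>, \<open>j\<close> change the scale inside
      \<open>z ^ j\<close> from \<open>\<beta>\<close> to \<open>\<tau>\<close>; the remaining
      \<open>i - j\<close> belong to the binomial weight.\<close>
    have "(\<beta>\<^sup>2 / \<tau>\<^sup>2) ^ i * z ^ j = p ^ j * (\<beta>\<^sup>2 / \<tau>\<^sup>2) ^ (i - j) * (y\<^sup>2 / (2 * \<tau>\<^sup>2)) ^ j" if "j \<le> i" for j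
    proof -
      have "(\<beta>\<^sup>2 / \<tau>\<^sup>2) ^ i = (\<beta>\<^sup>2 / \<tau>\<^sup>2) ^ (i - j) * (\<beta>\<^sup>2 / \<tau>\<^sup>2) ^ j"
        using that by (simp flip: power_add)
      moreover have "(\<beta>\<^sup>2 / \<tau>\<^sup>2) ^ j * z ^ j = p ^ j * (y\<^sup>2 / (2 * \<tau>\<^sup>2)) ^ j"
        using assms(2) by (simp add: z_def mult.commute[of "\<tau>\<^sup>2"] flip: power_mult_distrib)
      ultimately show ?thesis
        by (simp add: mult_ac)
    qed
    then have "nu_density \<delta> 0 \<tau> y * (\<beta>\<^sup>2 / \<tau>\<^sup>2) ^ i * (real (i choose j) * z ^ j / pochhammer (\<delta> / 2) j) =
        mix_weight a \<beta> \<sigma> i j * nu_density \<delta> j \<tau> y" if "j \<le> i" for j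
      using that unfolding nu_density_eq[OF assms(1) \<tau>, of j] mix_weight_def \<tau>_def[symmetric] p_def[symmetric]
      by (simp add: mult_ac)
    then have "(c * exp z) * (\<Sum>j\<le>i. real (i choose j) * z ^ j / pochhammer (\<delta> / 2) j) =
        (\<Sum>j\<le>i. mix_weight a \<beta> \<sigma> i j * nu_density \<delta> j \<tau> y)"
      unfolding c sum_distrib_left by (intro sum.cong) auto
    then show ?thesis
      by (simp only: mult_ac)
  qed
  then show ?thesis
    using sums_mult[OF kummer_sums[where b = "\<delta> / 2" and z = z and i = i], of c] assms(1)
    unfolding p_def[symmetric] term_eq by simp
qed

section \<open>Finite mixtures and their weights\<close>

text \<open>Linearity of the integral turns the setwise combination into a measure given by a
  density, the form in which \<open>psi\<close> is defined.\<close>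

lemma measure_comb_density:
  assumes "finite K" "\<And>k. k \<in> K \<Longrightarrow> w k \<ge> 0"
    and g: "\<And>k. g k \<in> borel_measurable borel" "\<And>k x. g k x \<ge> 0"
  shows "measure_comb K w (\<lambda>k. density lborel (\<lambda>x. ennreal (g k x))) =
    density lborel (\<lambda>x. ennreal (\<Sum>k\<in>K. w k * g k x))"
proof (rule measure_eqI)
  fix A :: "real set"
  assume "A \<in> sets (measure_comb K w (\<lambda>k. density lborel (\<lambda>x. ennreal (g k x))))"
  then have [measurable]: "A \<in> sets borel" by simp
  note g(1)[measurable]
  have "(\<integral>\<^sup>+x. ennreal (\<Sum>k\<in>K. w k * g k x) * indicator A x \<partial>lborel) =
      (\<integral>\<^sup>+x. (\<Sum>k\<in>K. ennreal (w k) * (ennreal (g k x) * indicator A x)) \<partial>lborel)"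
    using assms(2) g(2)
    by (intro nn_integral_cong)
       (simp add: sum_ennreal[symmetric] ennreal_mult sum_distrib_right mult.assoc)
  also have "\<dots> = (\<Sum>k\<in>K. ennreal (w k) * (\<integral>\<^sup>+x. ennreal (g k x) * indicator A x \<partial>lborel))"
    by (subst nn_integral_sum) (auto intro!: sum.cong nn_integral_cmult)
  finally show "emeasure (measure_comb K w (\<lambda>k. density lborel (\<lambda>x. ennreal (g k x)))) A =
      emeasure (density lborel (\<lambda>x. ennreal (\<Sum>k\<in>K. w k * g k x))) A"
    by (simp add: emeasure_measure_comb emeasure_density)
qed simp

lemma sq_div_tau_sq_le_1: "\<beta>\<^sup>2 / (tau a \<beta> \<sigma>)\<^sup>2 \<le> 1"
proof -
  have "0 \<le> \<beta>\<^sup>2" "0 \<le> a\<^sup>2 * \<sigma>\<^sup>2"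
    by simp_all
  then show ?thesis
    unfolding tau_sq divide_le_eq_1 by linarith
qed

lemma mix_weight_nonneg: "mix_weight a \<beta> \<sigma> i k \<ge> 0"
  using sq_div_tau_sq_le_1[of \<beta> a \<sigma>] by (simp add: mix_weight_def)

text \<open>Both success and failure probabilities are strictly positive, so the binomial
  coefficient alone decides.\<close>

lemma mix_weight_pos_iff:
  assumes "a > 0" "\<beta> > 0" "\<sigma> > 0"
  shows "mix_weight a \<beta> \<sigma> i k > 0 \<longleftrightarrow> k \<le> i"
proof -
  have "\<beta>\<^sup>2 / (tau a \<beta> \<sigma>)\<^sup>2 > 0" "1 - \<beta>\<^sup>2 / (tau a \<beta> \<sigma>)\<^sup>2 > 0"
    using assms by (simp_all add: tau_sq add_pos_pos)
  then show ?thesis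
    by (cases "k \<le> i") (simp_all add: mix_weight_def binomial_eq_0)
qed

section \<open>The image of \<open>nu\<close> under \<open>psi\<close>\<close>

text \<open>Works pointwise in \<open>y\<close>: expand the kernel over \<open>k\<close>, integrate
  in \<open>x\<close> term by term, and resum the resulting negative binomial series.\<close>

lemma psi_nu:
  assumes "\<delta> \<ge> 1" "\<beta> > 0" "\<sigma> > 0"
  shows "psi \<delta> a \<beta> (nu \<delta> i \<sigma>) =
    measure_comb {0..i} (mix_weight a \<beta> \<sigma> i) (\<lambda>k. nu \<delta> k (tau a \<beta> \<sigma>))"
proof -
  define \<tau> where "\<tau> = tau a \<beta> \<sigma>"
  have \<tau>: "\<tau> > 0"
    using assms by (simp add: tau_pos \<tau>_def)
  let ?c = "\<lambda>k. (\<beta> / \<tau>) powr (\<delta> + 2 * real i) *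
      (1 - \<beta>\<^sup>2 / \<tau>\<^sup>2) ^ k * pochhammer (\<delta> / 2 + real i) k / fact k"
  have "(\<integral>\<^sup>+ x\<in>{0<..}. ennreal (trans_density \<delta> a \<beta> x y) \<partial>nu \<delta> i \<sigma>) =
      ennreal (\<Sum>j\<le>i. mix_weight a \<beta> \<sigma> i j * nu_density \<delta> j \<tau> y)" for y
  proof -
    have "(\<integral>\<^sup>+ x\<in>{0<..}. ennreal (trans_density \<delta> a \<beta> x y) \<partial>nu \<delta> i \<sigma>) =
        (\<integral>\<^sup>+ x. ennreal (nu_density \<delta> i \<sigma> x) *
          (ennreal (trans_density \<delta> a \<beta> x y) * indicator {0<..} x) \<partial>lborel)"
      unfolding nu_def by (rule nn_integral_density) measurable
    also have "\<dots> = (\<integral>\<^sup>+ x. (\<Sum>k. ennreal (nu_density \<delta> i \<sigma> x * poisson_coeff a \<beta> k x) *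
        ennreal (nu_density \<delta> k \<beta> y)) \<partial>lborel)"
    proof (rule nn_integral_cong)
      fix x
      have "(\<Sum>k. ennreal (poisson_coeff a \<beta> k x * nu_density \<delta> k \<beta> y)) =
          ennreal (trans_density \<delta> a \<beta> x y)"
        using assms by (intro suminf_ennreal_eq trans_density_sums mult_nonneg_nonneg
          poisson_coeff_nonneg nu_density_nonneg)
      \<comment> \<open>The density of \<open>nu\<close> vanishes off the positive half-line, which
        absorbs the restriction of the integral in \<open>psi\<close>.\<close>
      moreover have "ennreal (nu_density \<delta> i \<sigma> x) * indicator {0<..} x = ennreal (nu_density \<delta> i \<sigma> x)"
        by (simp add: nu_density_def indicator_def)
      ultimately have "ennreal (nu_density \<delta> i \<sigma> x) *
          (ennreal (trans_density \<delta> a \<beta> x y) * indicator {0<..} x) =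
          ennreal (nu_density \<delta> i \<sigma> x) * (\<Sum>k. ennreal (poisson_coeff a \<beta> k x * nu_density \<delta> k \<beta> y))"
        by (metis mult.assoc mult.commute)
      also have "\<dots> = (\<Sum>k. ennreal (nu_density \<delta> i \<sigma> x * poisson_coeff a \<beta> k x) *
          ennreal (nu_density \<delta> k \<beta> y))"
        unfolding ennreal_suminf_cmult[symmetric]
        by (intro suminf_cong)
           (simp add: ennreal_mult poisson_coeff_nonneg nu_density_nonneg assms mult.assoc)
      finally show "ennreal (nu_density \<delta> i \<sigma> x) *
          (ennreal (trans_density \<delta> a \<beta> x y) * indicator {0<..} x) = \<dots>" .
    qed
    \<comment> \<open>Sum and integral commute because all terms are nonnegative.\<close>
    also have "\<dots> = (\<Sum>k. ennreal (?c k) * ennreal (nu_density \<delta> k \<beta> y))"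
      using nn_integral_poisson_nu[OF assms, of i a]
      by (simp add: nn_integral_suminf nn_integral_multc \<tau>_def)
    also have "\<dots> = (\<Sum>k. ennreal (?c k * nu_density \<delta> k \<beta> y))"
      using assms by (intro suminf_cong ennreal_mult''[symmetric] nu_density_nonneg)
    also have "\<dots> = ennreal (\<Sum>j\<le>i. mix_weight a \<beta> \<sigma> i j * nu_density \<delta> j \<tau> y)"
    proof (rule suminf_ennreal_eq)
      fix k
      have "\<beta>\<^sup>2 / \<tau>\<^sup>2 \<le> 1"
        unfolding \<tau>_def by (rule sq_div_tau_sq_le_1)
      then show "0 \<le> ?c k * nu_density \<delta> k \<beta> y"
        using assms nu_density_nonneg[of \<delta> \<beta> k y] by (simp add: pochhammer_nonneg)
      show "(\<lambda>k. ?c k * nu_density \<delta> k \<beta> y) sums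
          (\<Sum>j\<le>i. mix_weight a \<beta> \<sigma> i j * nu_density \<delta> j \<tau> y)"
        unfolding \<tau>_def by (rule negbinomial_mixture_sums[OF assms(1,2)])
    qed
    finally show ?thesis .
  qed
  then have "psi \<delta> a \<beta> (nu \<delta> i \<sigma>) =
      density lborel (\<lambda>y. ennreal (\<Sum>j\<in>{0..i}. mix_weight a \<beta> \<sigma> i j * nu_density \<delta> j \<tau> y))"
    by (simp add: psi_def atLeast0AtMost)
  also have "\<dots> = measure_comb {0..i} (mix_weight a \<beta> \<sigma> i) (\<lambda>k. nu \<delta> k \<tau>)"
    unfolding nu_def using assms \<tau>
    by (intro measure_comb_density[symmetric]) (auto simp: mix_weight_nonneg nu_density_nonneg)
  finally show ?thesis
    by (simp add: \<tau>_def)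
qed

theorem proposition4p4:
  fixes \<delta> a \<beta> :: real
  assumes "\<delta> \<ge> 1" and "a > 0" and "\<beta> > 0"
  shows "\<forall>\<sigma>::real. \<sigma> > 0 \<longrightarrow>
    tau a \<beta> \<sigma> > 0 \<and> (tau a \<beta> \<sigma>)\<^sup>2 = \<beta>\<^sup>2 + a\<^sup>2 * \<sigma>\<^sup>2 \<and>
    (\<forall>i::nat.
      psi \<delta> a \<beta> (nu \<delta> i \<sigma>) =
        measure_comb {0..i} (mix_weight a \<beta> \<sigma> i) (\<lambda>k. nu \<delta> k (tau a \<beta> \<sigma>)) \<and>
      is_finite_mixture (mix_weight a \<beta> \<sigma> i) (\<lambda>k. nu \<delta> k (tau a \<beta> \<sigma>))
        (psi \<delta> a \<beta> (nu \<delta> i \<sigma>)) \<and>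
      mixture_length (mix_weight a \<beta> \<sigma> i) = i)"
proof (intro allI impI conjI)
  fix \<sigma> :: real and i :: nat
  assume \<sigma>: "\<sigma> > 0"
  show "tau a \<beta> \<sigma> > 0" "(tau a \<beta> \<sigma>)\<^sup>2 = \<beta>\<^sup>2 + a\<^sup>2 * \<sigma>\<^sup>2"
    using assms by (simp_all add: tau_pos tau_sq)
  show psi: "psi \<delta> a \<beta> (nu \<delta> i \<sigma>) =
      measure_comb {0..i} (mix_weight a \<beta> \<sigma> i) (\<lambda>k. nu \<delta> k (tau a \<beta> \<sigma>))"
    using assms \<sigma> by (intro psi_nu)
  have pos: "{k. 0 < mix_weight a \<beta> \<sigma> i k} = {0..i}"
    using assms \<sigma> by (auto simp: mix_weight_pos_iff)
  then show "mixture_length (mix_weight a \<beta> \<sigma> i) = i"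
    by (auto simp: mixture_length_def intro!: Max_eqI)
  \<comment> \<open>The mixture is indexed by nonzero weights and its length by positive ones;
    nonnegativity identifies the two index sets.\<close>
  have "mix_weight a \<beta> \<sigma> i k \<noteq> 0 \<longleftrightarrow> 0 < mix_weight a \<beta> \<sigma> i k" for k
    using mix_weight_nonneg[of a \<beta> \<sigma> i k] by linarith
  with pos have supp: "{k. mix_weight a \<beta> \<sigma> i k \<noteq> 0} = {0..i}"
    by simp
  define q where "q = \<beta>\<^sup>2 / (tau a \<beta> \<sigma>)\<^sup>2"
  \<comment> \<open>The weights are the terms of a binomial expansion, so they add up to 1.\<close>
  have "(\<Sum>k\<in>{0..i}. mix_weight a \<beta> \<sigma> i k) = ((1 - q) + q) ^ i"
    unfolding binomial_ring mix_weight_def q_def atLeast0AtMost ..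
  then have "(\<Sum>k\<in>{0..i}. mix_weight a \<beta> \<sigma> i k) = 1"
    by simp
  then show "is_finite_mixture (mix_weight a \<beta> \<sigma> i) (\<lambda>k. nu \<delta> k (tau a \<beta> \<sigma>))
      (psi \<delta> a \<beta> (nu \<delta> i \<sigma>))"
    by (simp add: is_finite_mixture_def mixture_param_def mix_weight_nonneg supp psi)
qed

end
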